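(* With probability at least $1-\alpha$ with respect to the sampling, the family $\{\mathcal{U}^{CS}_\epsilon:0<\epsilon<1\}$ simultaneously implies a probabilistic guarantee for $\mathbb{P}^*$, where $$\mathcal{U}^{CS}_\epsilon=\Big\{\hat{\boldsymbol\mu}+\mathbf{y}+\mathbf{C}^T\mathbf{w}:\ \mathbf{y},\mathbf{w}\in\mathbb{R}^d,\ \|\mathbf{y}\|\le\Gamma_1^B,\ \|\mathbf{w}\|\le\sqrt{\tfrac1\epsilon-1}\Big\}$$ and $\mathbf{C}^T\mathbf{C}=\hat{\boldsymbol\Sigma}+\Gamma_2^B\mathbf{I}$ is a Cholesky decomposition. Moreover, $$\delta^*(\mathbf{v}\mid\mathcal{U}^{CS}_\epsilon)=\hat{\boldsymbol\mu}^T\mathbf{v}+\Gamma_1^B\|\mathbf{v}\|_2+\sqrt{\frac{1-\epsilon}\epsilon}\sqrt{\mathbf{v}^T(\hat{\boldsymbol\Sigma}+\Gamma_2^B\mathbf{I})\mathbf{v}}.$$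
   Context: $0<\alpha<1$; $\mathcal{S}$ is a sample of $N$ points drawn i.i.d. from the unknown measure $\mathbb{P}^*$ on $\mathbb{R}^d$, supported in the ball of radius $R$; $\tilde{\mathbf{u}}$ is a random vector; $\hat{\boldsymbol\mu},\hat{\boldsymbol\Sigma}$ are the sample mean and sample covariance; $\|\cdot\|$ is the Euclidean norm and $\|\cdot\|_F$ the Frobenius norm. $\Gamma_1^B,\Gamma_2^B\ge0$ are (bootstrapped) thresholds of a test for the mean and covariance, whose confidence region is $$\mathcal{P}^{CS}=\{\mathbb{P}\text{ supported in the ball of radius }R:\ \|\mathbb{E}^{\mathbb{P}}[\tilde{\mathbf{u}}]-\hat{\boldsymbol\mu}\|_2\le\Gamma_1^B,\ \|\mathbb{E}^{\mathbb{P}}[\tilde{\mathbf{u}}\tilde{\mathbf{u}}^T]-\mathbb{E}^{\mathbb{P}}[\tilde{\mathbf{u}}]\mathbb{E}^{\mathbb{P}}[\tilde{\mathbf{u}}^T]-\hat{\boldsymbol\Sigma}\|_F\le\Gamma_2^B\}.$$ Standing assumption: the test is valid at level $\alpha$, i.e. $\mathbb{P}^*\in\mathcal{P}^{CS}$ with probability at least $1-\alpha$ with respect to the sampling. $\delta^*(\mathbf{v}\mid\mathcal{U})=\sup_{\mathbf{u}\in\mathcal{U}}\mathbf{v}^T\mathbf{u}$. A set $\mathcal{U}$ implies a probabilistic guarantee for $\mathbb{P}^*$ at level $\epsilon$ if for every $\mathbf{x}^*\in\mathbb{R}^k$ and every real-valued $f(\mathbf{u},\mathbf{x})$ concave in $\mathbf{u}$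 for all $\mathbf{x}$: $f(\mathbf{u},\mathbf{x}^* )\le0\ \forall\mathbf{u}\in\mathcal{U}$ implies $\mathbb{P}^*(f(\tilde{\mathbf{u}},\mathbf{x}^* )\le0)\ge1-\epsilon$. A family $\{\mathcal{U}_\epsilon:0<\epsilon<1\}$ simultaneously implies a probabilistic guarantee for $\mathbb{P}^*$ if for every $0<\epsilon<1$ the set $\mathcal{U}_\epsilon$ implies one at level $\epsilon$. *)

theory Defs
  imports "HOL-Probability.Probability"
begin

text \<open>
  The event \<open>Q\<close> need not be measurable (it may quantify over uncountably many functions),
  hence the inner-probability reading. For a measurable event this is \<open>prob {\<omega>. Q \<omega>} \<ge> p\<close>.
\<close>

definition with_prob_at_least :: "'w measure \<Rightarrow> real \<Rightarrow> ('w \<Rightarrow> bool) \<Rightarrow> bool" where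
  "with_prob_at_least M p Q \<longleftrightarrow>
     (\<exists>A\<in>sets M. p \<le> measure M A \<and> (\<forall>\<omega>\<in>A. Q \<omega>))"

definition iid_sample ::
  "'w measure \<Rightarrow> (real ^ 'd) measure \<Rightarrow> nat \<Rightarrow> (nat \<Rightarrow> 'w \<Rightarrow> real ^ 'd) \<Rightarrow> bool" where
  "iid_sample M P N X \<longleftrightarrow>
     prob_space.indep_vars M (\<lambda>_. borel) X {..<N} \<and> (\<forall>i<N. distr M borel (X i) = P)"

definition outer :: "real ^ 'd \<Rightarrow> real ^ 'd \<Rightarrow> real ^ 'd ^ 'd" where
  "outer u v = (\<chi> i j. u $ i * v $ j)"

definition frobenius_norm :: "real ^ 'd ^ 'd \<Rightarrow> real" where
  "frobenius_norm A = sqrt (\<Sum>i\<in>UNIV. \<Sum>j\<in>UNIV. (A $ i $ j)\<^sup>2)"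

definition sample_mean :: "nat \<Rightarrow> (nat \<Rightarrow> real ^ 'd) \<Rightarrow> real ^ 'd" where
  "sample_mean N x = (1 / real N) *\<^sub>R (\<Sum>i<N. x i)"

text \<open>
  The parameter \<open>c\<close> selects the normalisation: \<open>c = 0\<close> is the empirical covariance with
  factor \<open>1 / N\<close>, and \<open>c = 1\<close> the unbiased one with factor \<open>1 / (N - 1)\<close>.
\<close>

definition sample_cov :: "nat \<Rightarrow> nat \<Rightarrow> (nat \<Rightarrow> real ^ 'd) \<Rightarrow> real ^ 'd ^ 'd" where
  "sample_cov c N x = (1 / (real N - real c)) *\<^sub>R
     (\<Sum>i<N. outer (x i - sample_mean N x) (x i - sample_mean N x))"

definition ball_supported_prob :: "real \<Rightarrow> (real ^ 'd) measure \<Rightarrow> bool" where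
  "ball_supported_prob R P \<longleftrightarrow>
     prob_space P \<and> sets P = sets borel \<and> (AE u in P. norm u \<le> R)"

definition mean :: "(real ^ 'd) measure \<Rightarrow> real ^ 'd" where
  "mean P = (\<integral>u. u \<partial>P)"

definition covariance :: "(real ^ 'd) measure \<Rightarrow> real ^ 'd ^ 'd" where
  "covariance P = (\<integral>u. outer u u \<partial>P) - outer (mean P) (mean P)"

definition conf_region_CS ::
  "real \<Rightarrow> real ^ 'd \<Rightarrow> real ^ 'd ^ 'd \<Rightarrow> real \<Rightarrow> real \<Rightarrow> (real ^ 'd) measure set" where
  "conf_region_CS R \<mu> \<Sigma> \<Gamma>1 \<Gamma>2 =
     {P. ball_supported_prob R P \<and> norm (mean P - \<mu>) \<le> \<Gamma>1
         \<and> frobenius_norm (covariance P - \<Sigma>) \<le> \<Gamma>2}"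

text \<open>
  The linear order on the index type is the order of the coordinates, needed to speak of
  triangular matrices. The diagonal is only required to be nonnegative, since the decomposed
  matrix may be singular.
\<close>

definition cholesky_decomposition ::
  "real ^ 'd::{finite,linorder} ^ 'd::{finite,linorder} \<Rightarrow>
   real ^ 'd::{finite,linorder} ^ 'd::{finite,linorder} \<Rightarrow> bool" where
  "cholesky_decomposition C A \<longleftrightarrow>
     (\<forall>i j. j < i \<longrightarrow> C $ i $ j = 0) \<and> (\<forall>i. 0 \<le> C $ i $ i) \<and> transpose C ** C = A"

definition uncertainty_set_CS ::
  "real ^ 'd \<Rightarrow> real \<Rightarrow> real ^ 'd ^ 'd \<Rightarrow> real \<Rightarrow> (real ^ 'd) set" where
  "uncertainty_set_CS \<mu> \<Gamma>1 C \<epsilon> =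
     {\<mu> + y + transpose C *v w | y w. norm y \<le> \<Gamma>1 \<and> norm w \<le> sqrt (1 / \<epsilon> - 1)}"

definition support_fun :: "real ^ 'd \<Rightarrow> (real ^ 'd) set \<Rightarrow> ereal" where
  "support_fun v U = (SUP u\<in>U. ereal (v \<bullet> u))"

text \<open>
  The type argument carries the dimension of the decision vector \<open>x\<close>.
\<close>

definition implies_prob_guarantee ::
  "'k::finite itself \<Rightarrow> (real ^ 'd) measure \<Rightarrow> real \<Rightarrow> (real ^ 'd) set \<Rightarrow> bool" where
  "implies_prob_guarantee (_ :: 'k itself) P \<epsilon> U \<longleftrightarrow>
     (\<forall>(x0 :: real ^ 'k) (f :: real ^ 'd \<Rightarrow> real ^ 'k \<Rightarrow> real).
        (\<forall>x. concave_on UNIV (\<lambda>u. f u x)) \<longrightarrow> (\<forall>u\<in>U. f u x0 \<le> 0) \<longrightarrow>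
        1 - \<epsilon> \<le> measure P {u \<in> space P. f u x0 \<le> 0})"

definition simultaneously_implies_prob_guarantee ::
  "'k::finite itself \<Rightarrow> (real ^ 'd) measure \<Rightarrow> (real \<Rightarrow> (real ^ 'd) set) \<Rightarrow> bool" where
  "simultaneously_implies_prob_guarantee K P U \<longleftrightarrow>
     (\<forall>\<epsilon>. 0 < \<epsilon> \<and> \<epsilon> < 1 \<longrightarrow> implies_prob_guarantee K P \<epsilon> (U \<epsilon>))"

end

theory Submission
  imports Defs
begin

text \<open>
  A concave \<open>f\<close> that is nonpositive on a convex set \<open>U\<close> has a convex superlevel set \<open>{f > 0}\<close>, which
  is open and disjoint from \<open>U\<close>; a hyperplane therefore separates the two. Hence the guarantee at
  level \<open>\<epsilon>\<close> reduces to linear functions: it is enough that every open half-space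
  \<open>{u. b < v \<bullet> u}\<close> missing \<open>U\<close> has probability at most \<open>\<epsilon>\<close>
  (\<open>implies_prob_guarantee_if_halfspaces\<close>).

  A half-space misses \<open>U\<close> exactly when \<open>b\<close> is at least the support function of \<open>U\<close> at \<open>v\<close>. For the
  set at hand, a Minkowski sum of a point, a ball and a linear image of a ball, Cauchy--Schwarz
  computes this function explicitly (\<open>support_fun_uncertainty_set_CS\<close>).

  If the true distribution lies in the confidence region, the first two terms of the support
  function bound the mean of \<open>v \<bullet> u\<close>. The Frobenius norm is the norm of the inner product of
  matrices, and a quadratic form in \<open>v\<close> is the inner product of its matrix with \<open>outer v v\<close>; so by
  Cauchy--Schwarz the variance of \<open>v \<bullet> u\<close> exceeds the one given by the sample covariance by at most
  \<open>\<Gamma>2 * (norm v)\<^sup>2\<close>, and the third term is at least \<open>sqrt (1 / \<epsilon> - 1)\<close> standard deviations.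
  Cantelli's one-sided version of Chebyshev's inequality bounds the probability of exceeding the
  mean by more than \<open>\<kappa>\<close> standard deviations by \<open>1 / (1 + \<kappa>\<^sup>2)\<close>, which is \<open>\<epsilon>\<close> for this \<open>\<kappa>\<close>.
  The argument treats all \<open>\<epsilon>\<close> on the same sampling event, on which the confidence region contains
  the true distribution; this is why the guarantee is simultaneous.
\<close>

section \<open>The one-sided Chebyshev inequality\<close>

text \<open>
  Markov's inequality is applied to the square of the centred variable shifted by
  \<open>variance Y / t\<close>, the shift that minimises the resulting bound.
\<close>

lemma (in prob_space) Cantelli_inequality:
  fixes Y :: "'a \<Rightarrow> real"
  assumes [measurable]: "random_variable borel Y"
    and Y2: "integrable M (\<lambda>x. (Y x)\<^sup>2)"
    and t: "0 < t"
  shows "prob {x\<in>space M. t \<le> Y x - expectation Y} \<le> variance Y / (variance Y + t\<^sup>2)"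
proof -
  define V where "V = variance Y"
  define a where "a = V / t"
  define Z where "Z x = Y x - expectation Y" for x
  have [measurable]: "Z \<in> borel_measurable M"
    by (simp add: Z_def[abs_def])
  have V: "0 \<le> V" "0 \<le> a"
    using t by (auto simp: V_def a_def)
  have Y: "integrable M Y"
    using Y2 by (rule square_integrable_imp_integrable[rotated]) simp
  have Z: "integrable M Z"
    using Y by (simp add: Z_def[abs_def])
  have Z2: "integrable M (\<lambda>x. (Z x)\<^sup>2)"
    using Y Y2 by (simp add: Z_def power2_diff mult.assoc)
  have EZ: "expectation Z = 0"
    using Y by (simp add: Z_def[abs_def] prob_space)
  have expand: "(Z x + a)\<^sup>2 = (Z x)\<^sup>2 + 2 * a * Z x + a\<^sup>2" for x
    by (simp add: power2_eq_square algebra_simps)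
  have int: "integrable M (\<lambda>x. (Z x + a)\<^sup>2)"
    using Z Z2 by (simp add: expand)
  have "prob {x\<in>space M. t \<le> Y x - expectation Y} \<le> prob {x\<in>space M. (t + a)\<^sup>2 \<le> (Z x + a)\<^sup>2}"
  proof (rule finite_measure_mono)
    show "{x\<in>space M. t \<le> Y x - expectation Y} \<subseteq> {x\<in>space M. (t + a)\<^sup>2 \<le> (Z x + a)\<^sup>2}"
      using t V by (auto simp: Z_def intro!: power_mono)
  qed simp
  also have "\<dots> \<le> expectation (\<lambda>x. (Z x + a)\<^sup>2) / (t + a)\<^sup>2"
    by (rule integral_Markov_inequality_measure[OF int, of "{}"]) (use t V in auto)
  also have "expectation (\<lambda>x. (Z x + a)\<^sup>2) = V + a\<^sup>2"
  proof -
    have "expectation (\<lambda>x. (Z x + a)\<^sup>2) = expectation (\<lambda>x. (Z x)\<^sup>2) + a\<^sup>2"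
      using Z Z2 EZ by (simp add: expand prob_space)
    then show ?thesis
      by (simp add: V_def Z_def)
  qed
  also have "(V + a\<^sup>2) / (t + a)\<^sup>2 = V / (V + t\<^sup>2)"
  proof -
    have pos: "0 < V + t\<^sup>2"
      using t V by (simp add: add_nonneg_pos)
    have num: "V + a\<^sup>2 = V * (V + t\<^sup>2) / t\<^sup>2"
      using t by (simp add: a_def field_simps power2_eq_square)
    have den: "(t + a)\<^sup>2 = (V + t\<^sup>2)\<^sup>2 / t\<^sup>2"
      using t by (simp add: a_def field_simps power2_eq_square)
    show ?thesis
      using t pos unfolding num den by (simp add: power2_eq_square)
  qed
  finally show ?thesis
    by (simp add: V_def)
qed

text \<open>
  The inequality \<open><\<close> in the event is what keeps the bound true for a variable that is almost surely
  constant.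
\<close>

corollary (in prob_space) Cantelli_inequality_stddev:
  fixes Y :: "'a \<Rightarrow> real"
  assumes [measurable]: "random_variable borel Y"
    and Y2: "integrable M (\<lambda>x. (Y x)\<^sup>2)"
    and k: "0 < k"
  shows "prob {x\<in>space M. expectation Y + k * sqrt (variance Y) < Y x} \<le> 1 / (1 + k\<^sup>2)"
proof (cases "variance Y = 0")
  case True
  have "integrable M Y"
    using Y2 by (rule square_integrable_imp_integrable[rotated]) simp
  then have "integrable M (\<lambda>x. (Y x - expectation Y)\<^sup>2)"
    using Y2 by (simp add: power2_diff mult.assoc)
  then have "AE x in M. (Y x - expectation Y)\<^sup>2 = 0"
    using True by (subst (asm) integral_nonneg_eq_0_iff_AE) auto
  then have "AE x in M. \<not> expectation Y + k * sqrt (variance Y) < Y x"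
    by eventually_elim (simp add: True)
  then have "prob {x\<in>space M. expectation Y + k * sqrt (variance Y) < Y x} = 0"
    by (subst prob_eq_0) auto
  then show ?thesis
    by simp
next
  case False
  define V where "V = variance Y"
  have V: "0 < V"
    using False by (simp add: V_def order_less_le)
  have "prob {x\<in>space M. expectation Y + k * sqrt V < Y x}
      \<le> prob {x\<in>space M. k * sqrt V \<le> Y x - expectation Y}"
    by (rule finite_measure_mono) auto
  also have "\<dots> \<le> V / (V + (k * sqrt V)\<^sup>2)"
    using Cantelli_inequality[OF assms(1) Y2, of "k * sqrt V"] k V by (simp add: V_def)
  also have "\<dots> = 1 / (1 + k\<^sup>2)"
  proof -
    have "V + (k * sqrt V)\<^sup>2 = V * (1 + k\<^sup>2)"
      using V by (simp add: power_mult_distrib algebra_simps)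
    then show ?thesis
      using V by simp
  qed
  finally show ?thesis
    by (simp add: V_def)
qed

section \<open>Quadratic forms and the Frobenius norm\<close>

lemma frobenius_norm_eq_norm: "frobenius_norm A = norm A"
  by (simp add: frobenius_norm_def norm_vec_def L2_set_def sum_nonneg)

text \<open>
  Quadratic forms are inner products with rank-one matrices; this turns statements about
  covariances into linear ones and makes Cauchy--Schwarz in the matrix space applicable.
\<close>

lemma inner_outer: "A \<bullet> outer v w = v \<bullet> (A *v w)"
  by (simp add: inner_vec_def outer_def matrix_vector_mult_def sum_distrib_left mult_ac)

lemma inner_outer_outer: "outer u v \<bullet> outer a b = (u \<bullet> a) * (v \<bullet> b)"
  by (simp add: inner_vec_def outer_def sum_product mult_ac)

lemma norm_outer: "norm (outer u v) = norm u * norm v"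
  by (simp add: norm_eq_sqrt_inner inner_outer_outer real_sqrt_mult)

lemma quadratic_form_le_frobenius: "v \<bullet> (A *v v) \<le> frobenius_norm A * (norm v)\<^sup>2"
  using norm_cauchy_schwarz[of A "outer v v"]
  by (simp add: inner_outer norm_outer frobenius_norm_eq_norm power2_eq_square)

lemma inner_transpose_mult_vector:
  fixes C :: "real ^ 'n ^ 'm"
  shows "v \<bullet> (transpose C *v w) = (C *v v) \<bullet> w"
  by (metis dot_lmul_matrix inner_commute transpose_matrix_vector)

lemma quadratic_form_transpose_mult:
  fixes C :: "real ^ 'n ^ 'm"
  shows "v \<bullet> ((transpose C ** C) *v v) = (norm (C *v v))\<^sup>2"
  by (simp only: matrix_vector_mul_assoc[symmetric] inner_transpose_mult_vector power2_norm_eq_inner)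

section \<open>Moments of linear functionals\<close>

context
  fixes R :: real and P :: "(real ^ 'd) measure"
  assumes P: "ball_supported_prob R P"
begin

interpretation prob_space P
  using P by (simp add: ball_supported_prob_def)

private lemma sets_P [measurable_cong]: "sets P = sets borel"
  using P by (simp add: ball_supported_prob_def)

private lemma integrable_ident: "integrable P (\<lambda>u. u)"
  by (rule integrable_const_bound[of _ R])
    (use P in \<open>simp_all add: ball_supported_prob_def measurable_ident_sets\<close>)

private lemma integrable_outer: "integrable P (\<lambda>u. outer u u)"
proof (rule integrable_const_bound[of _ "R\<^sup>2"])
  have "AE u in P. norm u \<le> R"
    using P by (simp add: ball_supported_prob_def)
  then show "AE u in P. norm (outer u u) \<le> R\<^sup>2"
    by eventually_elim (metis norm_ge_zero norm_outer power2_eq_square power_mono)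
  have "continuous_on UNIV (\<lambda>u :: real ^ 'd. outer u u)"
    unfolding outer_def by (intro continuous_intros)
  then show "(\<lambda>u. outer u u) \<in> borel_measurable P"
    using borel_measurable_continuous_onI measurable_cong_sets[OF sets_P refl] by blast
qed

lemma expectation_inner: "integral\<^sup>L P (\<lambda>u. v \<bullet> u) = v \<bullet> mean P"
  by (simp add: mean_def integrable_ident)

private lemma inner_square: "(v \<bullet> u)\<^sup>2 = outer u u \<bullet> outer v v"
  by (simp add: inner_outer_outer power2_eq_square inner_commute)

lemma integrable_inner_square: "integrable P (\<lambda>u. (v \<bullet> u)\<^sup>2)"
  unfolding inner_square by (intro integrable_inner_left integrable_outer)

lemma variance_inner:
  "integral\<^sup>L P (\<lambda>u. (v \<bullet> u - v \<bullet> mean P)\<^sup>2) = v \<bullet> (covariance P *v v)"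
proof -
  have "integrable P (\<lambda>u. v \<bullet> u)"
    by (intro integrable_inner_right integrable_ident)
  then have "integral\<^sup>L P (\<lambda>u. (v \<bullet> u - v \<bullet> mean P)\<^sup>2)
      = integral\<^sup>L P (\<lambda>u. (v \<bullet> u)\<^sup>2) - (v \<bullet> mean P)\<^sup>2"
    using variance_eq[OF _ integrable_inner_square] by (simp only: expectation_inner)
  also have "\<dots> = covariance P \<bullet> outer v v"
    by (simp add: inner_square covariance_def integrable_outer inner_diff_left)
  finally show ?thesis
    by (simp add: inner_outer)
qed

lemma prob_halfspace_le:
  assumes k: "0 < k"
  shows "measure P {u. v \<bullet> mean P + k * sqrt (v \<bullet> (covariance P *v v)) < v \<bullet> u} \<le> 1 / (1 + k\<^sup>2)"
  using Cantelli_inequality_stddev[of "\<lambda>u. v \<bullet> u", OF _ integrable_inner_square k]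
  by (simp add: expectation_inner variance_inner sets_eq_imp_space_eq[OF sets_P])

end

section \<open>Reduction to half-spaces\<close>

text \<open>
  Openness of the superlevel set, that is continuity of finite concave functions, makes the
  separation strict on its side.
\<close>

lemma implies_prob_guarantee_if_halfspaces:
  fixes P :: "(real ^ 'd) measure" and U :: "(real ^ 'd) set"
  assumes P: "prob_space P" and sets: "sets P = sets borel"
    and \<epsilon>: "0 \<le> \<epsilon>"
    and U: "convex U" "U \<noteq> {}"
    and half: "\<And>v b. (\<And>u. u \<in> U \<Longrightarrow> v \<bullet> u \<le> b) \<Longrightarrow> measure P {u. b < v \<bullet> u} \<le> \<epsilon>"
  shows "implies_prob_guarantee TYPE('k::finite) P \<epsilon> U"
  unfolding implies_prob_guarantee_def
proof (intro allI impI)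
  fix x0 :: "real ^ 'k" and f :: "real ^ 'd \<Rightarrow> real ^ 'k \<Rightarrow> real"
  assume "\<forall>x. concave_on UNIV (\<lambda>u. f u x)" and f_le: "\<forall>u\<in>U. f u x0 \<le> 0"
  then have f: "concave_on UNIV (\<lambda>u. f u x0)"
    by blast
  interpret prob_space P
    by (rule P)
  note sets[measurable_cong]
  have space: "space P = UNIV"
    using sets_eq_imp_space_eq[OF sets] by simp
  define T where "T = {u. 0 < f u x0}"
  have "continuous_on UNIV (\<lambda>u. - f u x0)"
    using f by (intro convex_on_continuous) (auto simp: concave_on_def)
  then have "continuous_on UNIV (\<lambda>u. f u x0)"
    using continuous_on_minus by fastforce
  then have openT: "open T"
    unfolding T_def by (intro open_Collect_less) auto
  have convexT: "convex T"
  proof (rule convexI)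
    fix a b :: "real ^ 'd" and s t :: real
    assume "a \<in> T" "b \<in> T" and st: "0 \<le> s" "0 \<le> t" "s + t = 1"
    then have "0 < s * f a x0 + t * f b x0"
      unfolding T_def
      by (metis (mono_tags) add_nonneg_pos add_pos_nonneg less_eq_real_def mem_Collect_eq
          mult_nonneg_nonneg mult_pos_pos zero_neq_one add.right_neutral)
    also have "\<dots> \<le> f (s *\<^sub>R a + t *\<^sub>R b) x0"
      using f st by (simp add: concave_on_iff)
    finally show "s *\<^sub>R a + t *\<^sub>R b \<in> T"
      by (simp add: T_def)
  qed
  have "measure P T \<le> \<epsilon>"
  proof (cases "T = {}")
    case False
    have "U \<inter> T = {}"
      using f_le by (force simp: T_def)
    then obtain v b where v: "v \<noteq> 0" and Ub: "\<forall>u\<in>U. v \<bullet> u \<le> b" and Tb: "\<forall>u\<in>T. b \<le> v \<bullet> u"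
      using separating_hyperplane_sets[OF U(1) convexT U(2) False] by blast
    have "T \<subseteq> interior {u. b \<le> v \<bullet> u}"
      using Tb openT by (intro interior_maximal) auto
    then have "T \<subseteq> {u. b < v \<bullet> u}"
      using v by simp
    then have "measure P T \<le> measure P {u. b < v \<bullet> u}"
      by (rule finite_measure_mono) (simp add: sets)
    also have "\<dots> \<le> \<epsilon>"
      using Ub by (intro half) auto
    finally show ?thesis .
  qed (use \<epsilon> in simp)
  moreover have "{u\<in>space P. f u x0 \<le> 0} = space P - T"
    by (auto simp: T_def space)
  moreover have "T \<in> sets P"
    using openT by (simp add: sets)
  ultimately show "1 - \<epsilon> \<le> measure P {u\<in>space P. f u x0 \<le> 0}"
    by (simp add: prob_compl)
qed

section \<open>The uncertainty set\<close>

lemma uncertainty_set_CS_I: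
  assumes "norm y \<le> \<Gamma>" and "norm w \<le> sqrt (1 / \<epsilon> - 1)"
  shows "\<mu> + y + transpose C *v w \<in> uncertainty_set_CS \<mu> \<Gamma> C \<epsilon>"
  unfolding uncertainty_set_CS_def using assms by blast

lemma convex_uncertainty_set_CS: "convex (uncertainty_set_CS \<mu> \<Gamma> C \<epsilon>)"
proof -
  have "uncertainty_set_CS \<mu> \<Gamma> C \<epsilon> = (+) \<mu> ` (\<lambda>p. fst p + transpose C *v snd p) `
      (cball 0 \<Gamma> \<times> cball 0 (sqrt (1 / \<epsilon> - 1)))"
    unfolding uncertainty_set_CS_def image_image
    by (auto simp: image_def Bex_def add.assoc)
  also have "convex \<dots>"
    by (intro convex_translation convex_linear_image convex_Times convex_cball)
      (auto simp: linear_iff matrix_vector_right_distrib matrix_vector_mult_scaleR scaleR_add_right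
        simp del: transpose_matrix_vector)
  finally show ?thesis .
qed

text \<open>
  The supremum over each ball is attained at the multiple of the given direction that has maximal
  norm. For direction \<open>0\<close> this multiple is \<open>0\<close>, by \<open>sgn 0 = 0\<close>, which still attains it.
\<close>

lemma support_fun_uncertainty_set_CS:
  assumes \<Gamma>: "0 \<le> \<Gamma>" and \<epsilon>: "0 < \<epsilon>" "\<epsilon> < 1"
  shows "support_fun v (uncertainty_set_CS \<mu> \<Gamma> C \<epsilon>)
    = ereal (\<mu> \<bullet> v + \<Gamma> * norm v + sqrt ((1 - \<epsilon>) / \<epsilon>) * norm (C *v v))"
    (is "_ = ereal ?s")
proof -
  define r where "r = sqrt (1 / \<epsilon> - 1)"
  have r: "0 \<le> r" "sqrt ((1 - \<epsilon>) / \<epsilon>) = r"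
    using \<epsilon> by (auto simp: r_def field_simps)
  have inner: "v \<bullet> (\<mu> + y + transpose C *v w) = \<mu> \<bullet> v + v \<bullet> y + (C *v v) \<bullet> w" for y w
    by (simp add: inner_add_right inner_transpose_mult_vector inner_commute del: transpose_matrix_vector)
  have sgn_inner: "x \<bullet> sgn x = norm x" for x :: "'b::real_inner"
    by (cases "x = 0") (simp_all add: sgn_div_norm dot_square_norm power2_eq_square)
  define u where "u = \<mu> + \<Gamma> *\<^sub>R sgn v + transpose C *v (r *\<^sub>R sgn (C *v v))"
  have "u \<in> uncertainty_set_CS \<mu> \<Gamma> C \<epsilon>"
    unfolding u_def using \<Gamma> r(1)
    by (intro uncertainty_set_CS_I) (auto simp: norm_sgn r_def[symmetric])
  moreover have "v \<bullet> u = ?s"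
    by (simp add: u_def inner sgn_inner r(2) del: transpose_matrix_vector)
  moreover have "v \<bullet> u' \<le> ?s" if "u' \<in> uncertainty_set_CS \<mu> \<Gamma> C \<epsilon>" for u'
  proof -
    obtain y w where u': "u' = \<mu> + y + transpose C *v w" and y: "norm y \<le> \<Gamma>" and w: "norm w \<le> r"
      using \<open>u' \<in> _\<close> by (auto simp: uncertainty_set_CS_def r_def)
    have "v \<bullet> y \<le> \<Gamma> * norm v"
      using norm_cauchy_schwarz[of v y] mult_left_mono[OF y norm_ge_zero[of v]]
      by (simp add: mult.commute)
    moreover have "(C *v v) \<bullet> w \<le> r * norm (C *v v)"
      using norm_cauchy_schwarz[of "C *v v" w] mult_left_mono[OF w norm_ge_zero[of "C *v v"]]
      by (simp add: mult.commute)
    ultimately show ?thesis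
      by (simp add: u' inner r(2) del: transpose_matrix_vector)
  qed
  ultimately show ?thesis
    unfolding support_fun_def by (intro antisym SUP_least) (auto intro: SUP_upper2)
qed

text \<open>
  The confidence region bounds the mean and the variance of every linear functional \<open>v \<bullet> u\<close> so that
  mean plus \<open>sqrt ((1 - \<epsilon>) / \<epsilon>)\<close> standard deviations is at most the support function; the rest is
  Cantelli's inequality for the half-spaces that miss the set.
\<close>

lemma implies_prob_guarantee_uncertainty_set_CS:
  fixes P :: "(real ^ 'd) measure"
  assumes PR: "P \<in> conf_region_CS R \<mu> \<Sigma> \<Gamma>1 \<Gamma>2"
    and C: "transpose C ** C = \<Sigma> + \<Gamma>2 *\<^sub>R mat 1"
    and \<epsilon>: "0 < \<epsilon>" "\<epsilon> < 1"
  shows "implies_prob_guarantee TYPE('k::finite) P \<epsilon> (uncertainty_set_CS \<mu> \<Gamma>1 C \<epsilon>)"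
proof -
  define r where "r = sqrt ((1 - \<epsilon>) / \<epsilon>)"
  have r: "0 < r" "1 / (1 + r\<^sup>2) = \<epsilon>"
    using \<epsilon> by (auto simp: r_def field_simps)
  have P: "ball_supported_prob R P" and m: "norm (mean P - \<mu>) \<le> \<Gamma>1"
    and S: "frobenius_norm (covariance P - \<Sigma>) \<le> \<Gamma>2"
    using PR by (auto simp: conf_region_CS_def)
  have \<Gamma>1: "0 \<le> \<Gamma>1"
    using m norm_ge_zero order_trans by blast
  have prob: "prob_space P" and sets: "sets P = sets borel"
    using P by (auto simp: ball_supported_prob_def)
  interpret prob_space P
    by (rule prob)
  show ?thesis
  proof (rule implies_prob_guarantee_if_halfspaces[OF prob sets])
    have "\<mu> + 0 + transpose C *v 0 \<in> uncertainty_set_CS \<mu> \<Gamma>1 C \<epsilon>"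
      using \<Gamma>1 \<epsilon> by (intro uncertainty_set_CS_I) (simp_all add: field_simps)
    then show "uncertainty_set_CS \<mu> \<Gamma>1 C \<epsilon> \<noteq> {}"
      by blast
  next
    fix v b
    assume "\<And>u. u \<in> uncertainty_set_CS \<mu> \<Gamma>1 C \<epsilon> \<Longrightarrow> v \<bullet> u \<le> b"
    then have "support_fun v (uncertainty_set_CS \<mu> \<Gamma>1 C \<epsilon>) \<le> ereal b"
      unfolding support_fun_def by (intro SUP_least) simp
    then have b: "\<mu> \<bullet> v + \<Gamma>1 * norm v + r * norm (C *v v) \<le> b"
      by (simp add: support_fun_uncertainty_set_CS \<Gamma>1 \<epsilon> r_def)
    have "v \<bullet> mean P - \<mu> \<bullet> v = v \<bullet> (mean P - \<mu>)"
      by (simp add: inner_diff_right inner_commute)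
    also have "\<dots> \<le> norm v * norm (mean P - \<mu>)"
      by (rule norm_cauchy_schwarz)
    also have "\<dots> \<le> \<Gamma>1 * norm v"
      using mult_left_mono[OF m norm_ge_zero[of v]] by (simp add: mult.commute)
    finally have mean_le: "v \<bullet> mean P \<le> \<mu> \<bullet> v + \<Gamma>1 * norm v"
      by simp
    have "v \<bullet> (covariance P *v v) = v \<bullet> (\<Sigma> *v v) + v \<bullet> ((covariance P - \<Sigma>) *v v)"
      by (simp add: inner_diff_right matrix_vector_mult_diff_rdistrib)
    also have "\<dots> \<le> v \<bullet> (\<Sigma> *v v) + frobenius_norm (covariance P - \<Sigma>) * (norm v)\<^sup>2"
      by (intro add_left_mono quadratic_form_le_frobenius)
    also have "\<dots> \<le> v \<bullet> (\<Sigma> *v v) + \<Gamma>2 * (norm v)\<^sup>2"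
      using S by (intro add_left_mono mult_right_mono) auto
    also have "\<dots> = v \<bullet> ((\<Sigma> + \<Gamma>2 *\<^sub>R mat 1) *v v)"
      by (simp add: matrix_vector_mult_add_rdistrib scaleR_matrix_vector_assoc[symmetric]
          inner_add_right power2_norm_eq_inner)
    also have "\<dots> = (norm (C *v v))\<^sup>2"
      by (simp only: C[symmetric] quadratic_form_transpose_mult)
    finally have "sqrt (v \<bullet> (covariance P *v v)) \<le> norm (C *v v)"
      by (rule real_le_lsqrt[rotated]) simp
    then have "r * sqrt (v \<bullet> (covariance P *v v)) \<le> r * norm (C *v v)"
      using r(1) by (intro mult_left_mono) auto
    with mean_le b have "v \<bullet> mean P + r * sqrt (v \<bullet> (covariance P *v v)) \<le> b"
      by linarith
    then have "{u. b < v \<bullet> u} \<subseteq> {u. v \<bullet> mean P + r * sqrt (v \<bullet> (covariance P *v v)) < v \<bullet> u}"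
      by auto
    then have "measure P {u. b < v \<bullet> u}
        \<le> measure P {u. v \<bullet> mean P + r * sqrt (v \<bullet> (covariance P *v v)) < v \<bullet> u}"
      by (rule finite_measure_mono) (simp add: sets)
    also have "\<dots> \<le> \<epsilon>"
      using prob_halfspace_le[OF P r(1)] r(2) by simp
    finally show "measure P {u. b < v \<bullet> u} \<le> \<epsilon>" .
  qed (use \<epsilon> in \<open>simp_all add: convex_uncertainty_set_CS\<close>)
qed

theorem theorem10:
  fixes M :: "'w measure"
    and P :: "(real ^ 'd::{finite,linorder}) measure"
    and X :: "nat \<Rightarrow> 'w \<Rightarrow> real ^ 'd::{finite,linorder}"
    and \<Gamma>1 \<Gamma>2 :: "'w \<Rightarrow> real"
    and C :: "'w \<Rightarrow> real ^ 'd::{finite,linorder} ^ 'd::{finite,linorder}"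
    and \<alpha> R :: real
    and N c :: nat
  assumes "0 < \<alpha>" and "\<alpha> < 1"
    and "prob_space M"
    and "ball_supported_prob R P"
    and "c \<in> {0, 1}" and "c < N"
    and "iid_sample M P N X"
    and "\<And>\<omega>. \<omega> \<in> space M \<Longrightarrow> 0 \<le> \<Gamma>1 \<omega>"
    and "\<And>\<omega>. \<omega> \<in> space M \<Longrightarrow> 0 \<le> \<Gamma>2 \<omega>"
    and "with_prob_at_least M (1 - \<alpha>)
           (\<lambda>\<omega>. P \<in> conf_region_CS R (sample_mean N (\<lambda>i. X i \<omega>)) (sample_cov c N (\<lambda>i. X i \<omega>))
                     (\<Gamma>1 \<omega>) (\<Gamma>2 \<omega>))"
    and "\<And>\<omega>. \<omega> \<in> space M \<Longrightarrow>
           cholesky_decomposition (C \<omega>) (sample_cov c N (\<lambda>i. X i \<omega>) + \<Gamma>2 \<omega> *\<^sub>R mat 1)"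
  shows "with_prob_at_least M (1 - \<alpha>)
           (\<lambda>\<omega>. simultaneously_implies_prob_guarantee TYPE('k::finite) P
                  (uncertainty_set_CS (sample_mean N (\<lambda>i. X i \<omega>)) (\<Gamma>1 \<omega>) (C \<omega>)))
         \<and> (\<forall>\<omega>\<in>space M. \<forall>\<epsilon>. 0 < \<epsilon> \<and> \<epsilon> < 1 \<longrightarrow> (\<forall>v.
              support_fun v (uncertainty_set_CS (sample_mean N (\<lambda>i. X i \<omega>)) (\<Gamma>1 \<omega>) (C \<omega>) \<epsilon>) =
              ereal (sample_mean N (\<lambda>i. X i \<omega>) \<bullet> v + \<Gamma>1 \<omega> * norm v
                + sqrt ((1 - \<epsilon>) / \<epsilon>)
                  * sqrt (v \<bullet> ((sample_cov c N (\<lambda>i. X i \<omega>) + \<Gamma>2 \<omega> *\<^sub>R mat 1) *v v)))))"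
proof (intro conjI ballI allI impI)
  have gram: "transpose (C \<omega>) ** C \<omega> = sample_cov c N (\<lambda>i. X i \<omega>) + \<Gamma>2 \<omega> *\<^sub>R mat 1"
    if "\<omega> \<in> space M" for \<omega>
    using assms(11)[OF that] by (simp add: cholesky_decomposition_def)
  obtain A where A: "A \<in> sets M" "1 - \<alpha> \<le> measure M A"
    and region: "\<And>\<omega>. \<omega> \<in> A \<Longrightarrow> P \<in> conf_region_CS R (sample_mean N (\<lambda>i. X i \<omega>))
      (sample_cov c N (\<lambda>i. X i \<omega>)) (\<Gamma>1 \<omega>) (\<Gamma>2 \<omega>)"
    using assms(10) unfolding with_prob_at_least_def by blast
  have "simultaneously_implies_prob_guarantee TYPE('k) P
      (uncertainty_set_CS (sample_mean N (\<lambda>i. X i \<omega>)) (\<Gamma>1 \<omega>) (C \<omega>))" if "\<omega> \<in> A" for \<omega>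
    unfolding simultaneously_implies_prob_guarantee_def
    using implies_prob_guarantee_uncertainty_set_CS[OF region[OF that] gram]
      sets.sets_into_space[OF A(1)] that by blast
  with A show "with_prob_at_least M (1 - \<alpha>)
      (\<lambda>\<omega>. simultaneously_implies_prob_guarantee TYPE('k) P
        (uncertainty_set_CS (sample_mean N (\<lambda>i. X i \<omega>)) (\<Gamma>1 \<omega>) (C \<omega>)))"
    unfolding with_prob_at_least_def by blast
next
  fix \<omega> and \<epsilon> :: real and v :: "real ^ 'd::{finite,linorder}"
  assume \<omega>: "\<omega> \<in> space M" and \<epsilon>: "0 < \<epsilon> \<and> \<epsilon> < 1"
  have norm_eq: "norm (C \<omega> *v v)
      = sqrt (v \<bullet> ((sample_cov c N (\<lambda>i. X i \<omega>) + \<Gamma>2 \<omega> *\<^sub>R mat 1) *v v))"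
    using assms(11)[OF \<omega>] quadratic_form_transpose_mult[of v "C \<omega>"]
    by (simp add: cholesky_decomposition_def)
  show "support_fun v (uncertainty_set_CS (sample_mean N (\<lambda>i. X i \<omega>)) (\<Gamma>1 \<omega>) (C \<omega>) \<epsilon>) =
      ereal (sample_mean N (\<lambda>i. X i \<omega>) \<bullet> v + \<Gamma>1 \<omega> * norm v
        + sqrt ((1 - \<epsilon>) / \<epsilon>)
          * sqrt (v \<bullet> ((sample_cov c N (\<lambda>i. X i \<omega>) + \<Gamma>2 \<omega> *\<^sub>R mat 1) *v v)))"
    using \<epsilon> by (simp only: support_fun_uncertainty_set_CS[OF assms(8)[OF \<omega>]] norm_eq)
qed

end
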